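(* For $n\ge3$ and $i,j\in[n]$ with $i\ne j$ let $t(n;i,j)=|\{\pi\in\mathrm{Av}_n^{123}(123,312):\pi_1=i,\ \pi_2=j\}|$. Then $$\Pr(123\prec312)=\sum_{n\ge3}\ \sum_{\substack{i,j=1\\ i\neq j}}^n\frac{t(n;i,j)}{n!}\approx0.342.$$
   Context: For a sequence of distinct reals, $\mathrm{st}$ replaces the smallest entry by $1$, the second smallest by $2$, etc. Let $X_1,X_2,\dots$ be i.i.d. continuous random variables (e.g. uniform on $[0,1]$). A consecutive occurrence of a permutation $\sigma$ of $\{1,\dots,k\}$ in a sequence or permutation is a block of $k$ adjacent entries whose standardization is $\sigma$. For distinct permutations $\sigma,\tau$ of the same length, $\Pr(\sigma\prec\tau)$ is the probability that the first consecutive occurrence of $\sigma$ in $X_1,X_2,\dots$ appears before the first consecutive occurrence of $\tau$. $\mathrm{Av}_n^{123}(123,312)$ is the set of permutations of $[n]=\{1,\dots,n\}$ whose last three entries form a consecutive occurrence of $123$ and which have no other consecutive occurrence of $123$ or $312$. *)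

theory Defs
  imports
    "HOL-Probability.Probability"
    "HOL-Combinatorics.Multiset_Permutations"
    "HOL-Library.Extended_Nat"
begin

text \<open>
  Permutations of $[n]$ are written in one-line notation, as lists in
  \<^term>\<open>permutations_of_set {1..n}\<close>; so $\pi_i$ is \<^term>\<open>p ! (i - 1)\<close>.
  Positions of blocks are counted from 0.
\<close>

definition standardize :: "'a::linorder list \<Rightarrow> nat list" where
  "standardize xs = map (\<lambda>x. card {y \<in> set xs. y \<le> x}) xs"

definition occurrences :: "nat list \<Rightarrow> 'a::linorder list \<Rightarrow> nat set" where
  "occurrences \<sigma> xs =
     {m. m + length \<sigma> \<le> length xs \<and> standardize (take (length \<sigma>) (drop m xs)) = \<sigma>}"

text \<open>
  A block containing a tie never counts as an occurrence of a permutation, because its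
  standardization is then not a permutation.
\<close>

definition seq_occurrences :: "nat list \<Rightarrow> (nat \<Rightarrow> 'a::linorder) \<Rightarrow> nat set" where
  "seq_occurrences \<sigma> x = {m. standardize (map x [m..<m + length \<sigma>]) = \<sigma>}"

text \<open>The first occurrence is at \<^term>\<open>\<infinity> :: enat\<close> if there is none.\<close>

definition first_occurrence :: "nat list \<Rightarrow> (nat \<Rightarrow> 'a::linorder) \<Rightarrow> enat" where
  "first_occurrence \<sigma> x = (INF m\<in>seq_occurrences \<sigma> x. enat m)"

definition prob_before ::
    "'a measure \<Rightarrow> (nat \<Rightarrow> 'a \<Rightarrow> real) \<Rightarrow> nat list \<Rightarrow> nat list \<Rightarrow> real" where
  "prob_before M X \<sigma> \<tau> =
     measure M {\<omega> \<in> space M. first_occurrence \<sigma> (\<lambda>n. X n \<omega>) < first_occurrence \<tau> (\<lambda>n. X n \<omega>)}"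

text \<open>``Continuous'' means that the common distribution function is continuous (no atoms);
  a density is not required.\<close>

definition iid_continuous :: "'a measure \<Rightarrow> (nat \<Rightarrow> 'a \<Rightarrow> real) \<Rightarrow> bool" where
  "iid_continuous M X \<longleftrightarrow>
     prob_space M \<and>
     prob_space.indep_vars M (\<lambda>_. borel) X UNIV \<and>
     (\<forall>n. distr M borel (X n) = distr M borel (X 0)) \<and>
     continuous_on UNIV (cdf (distr M borel (X 0)))"

text \<open>
  $\mathrm{Av}_n^{\sigma}(\sigma,\tau)$, for distinct $\sigma$, $\tau$ of the same length: the
  last entries form an occurrence of $\sigma$ and there is no other occurrence of $\sigma$ or
  $\tau$.
\<close>

definition Av_ending :: "nat \<Rightarrow> nat list \<Rightarrow> nat list \<Rightarrow> nat list set" where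
  "Av_ending n \<sigma> \<tau> =
     {p \<in> permutations_of_set {1..n}.
        occurrences \<sigma> p = {n - length \<sigma>} \<and> occurrences \<tau> p = {}}"

definition t_count :: "nat \<Rightarrow> nat \<Rightarrow> nat \<Rightarrow> nat" where
  "t_count n i j = card {p \<in> Av_ending n [1, 2, 3] [3, 1, 2]. p ! 0 = i \<and> p ! 1 = j}"

end

theory Submission
  imports Defs
begin

text \<open>
  Let \<open>\<sigma> \<noteq> \<tau>\<close> be of the same length. If \<open>\<sigma>\<close> wins the race against \<open>\<tau>\<close> and its first occurrence
  ends at the \<open>n\<close>-th entry, then the ordering of the first \<open>n\<close> entries is a permutation in the
  class \<^const>\<open>Av_ending\<close>, and conversely (lemma \<open>standardize_prefix_in_Av_ending_iff\<close>).
  Ties have probability zero and the variables are exchangeable, so each of the \<open>n!\<close> orderings has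
  probability \<open>1/n!\<close>. The events for different \<open>n\<close> are disjoint, and the probability that \<open>\<sigma>\<close> wins is
  the sum of the numbers \<open>|Av\<^sub>n| / n!\<close> (lemma \<open>has_sum_prob_before\<close>). For 123 and 312 the class splits
  according to the first two entries, which gives the double sum.

  The series does not depend on the law, so its value may be computed for uniform variables on
  \<open>[0,1]\<close>. Let \<open>win a b\<close> be the probability that 123 wins if the race starts with the entries \<open>a\<close>, \<open>b\<close>.
  Looking at the third entry gives \<open>win = p + continue win\<close>, where \<open>p a b\<close> is \<open>1 - b\<close> for \<open>a < b\<close>
  and \<open>0\<close> otherwise, and \<open>continue\<close> is a positive linear operator (lemma \<open>win_eq\<close>). Solutions are
  determined by a function \<open>C\<close> of one variable with
  \<open>C' s + s C s = C 1 - 1/2 + s + s\<^sup>2/2\<close> and \<open>C 0 = 0\<close> (lemma \<open>continue_reward\<close>), and the winning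
  probability is \<open>C 1 - 1/2\<close> plus the integral of \<open>C\<close> over \<open>[0,1]\<close>.

  The exact \<open>C\<close> is not elementary, but inequalities suffice. The operator is monotone and
  contracts a suitable weight function, so a bounded function that satisfies the equation with \<open>\<ge>\<close> or
  \<open>\<le>\<close> bounds \<open>win\<close> from above or below (lemmas \<open>nonpos_if_le_continue\<close> and \<open>prob_wins_compare\<close>).
  Truncated power series of \<open>C\<close> are polynomials with this property, and with rational coefficients they
  locate the probability between \<open>0.3415\<close> and \<open>0.3425\<close>.
\<close>

section \<open>Standardization and order isomorphism\<close>

definition order_iso :: "'a::linorder list \<Rightarrow> 'b::linorder list \<Rightarrow> bool" where
  "order_iso xs ys \<longleftrightarrow> length xs = length ys \<and>
     (\<forall>i<length xs. \<forall>j<length xs. xs ! i \<le> xs ! j \<longleftrightarrow> ys ! i \<le> ys ! j)"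

lemma length_standardize [simp]: "length (standardize xs) = length xs"
  by (simp add: standardize_def)

lemma order_iso_standardize: "order_iso (standardize xs) xs"
  unfolding order_iso_def
proof (intro conjI allI impI)
  show "length (standardize xs) = length xs" by simp
next
  fix i j assume "i < length (standardize xs)" "j < length (standardize xs)"
  then have i: "i < length xs" and j: "j < length xs" by simp_all
  show "standardize xs ! i \<le> standardize xs ! j \<longleftrightarrow> xs ! i \<le> xs ! j"
  proof
    assume le: "standardize xs ! i \<le> standardize xs ! j"
    show "xs ! i \<le> xs ! j"
    proof (rule ccontr)
      assume "\<not> xs ! i \<le> xs ! j"
      then have "{y \<in> set xs. y \<le> xs ! j} \<subset> {y \<in> set xs. y \<le> xs ! i}"
        using i by (auto simp: not_le psubset_eq) (metis (mono_tags) leD mem_Collect_eq nth_mem order_refl)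
      then have "card {y \<in> set xs. y \<le> xs ! j} < card {y \<in> set xs. y \<le> xs ! i}"
        by (intro psubset_card_mono) auto
      then show False
        using le i j by (simp add: standardize_def)
    qed
  next
    assume "xs ! i \<le> xs ! j"
    then show "standardize xs ! i \<le> standardize xs ! j"
      using i j by (auto simp: standardize_def intro!: card_mono)
  qed
qed

lemma order_iso_sym: "order_iso xs ys \<Longrightarrow> order_iso ys xs"
  by (auto simp: order_iso_def)

lemma order_iso_trans: "order_iso xs ys \<Longrightarrow> order_iso ys zs \<Longrightarrow> order_iso xs zs"
  by (auto simp: order_iso_def)

text \<open>
Matching equal positions gives a bijection between the values up to \<open>xs ! i\<close> and the values
up to \<open>ys ! i\<close>. Working with values rather than positions makes this valid for lists with ties.
\<close>

lemma order_iso_imp_standardize_eq: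
  assumes "order_iso xs ys"
  shows "standardize xs = standardize ys"
proof (rule nth_equalityI)
  show len: "length (standardize xs) = length (standardize ys)"
    using assms by (simp add: order_iso_def)
  fix i assume "i < length (standardize xs)"
  then have i: "i < length xs" by simp
  have le: "xs ! k \<le> xs ! l \<longleftrightarrow> ys ! k \<le> ys ! l" if "k < length xs" "l < length xs" for k l
    using assms that by (auto simp: order_iso_def)
  have eq: "xs ! k = xs ! l \<longleftrightarrow> ys ! k = ys ! l" if "k < length xs" "l < length xs" for k l
    using le[OF that] le[of l k] that by (metis antisym order_refl)
  define J where "J = {j. j < length xs \<and> xs ! j \<le> xs ! i}"
  have J': "J = {j. j < length ys \<and> ys ! j \<le> ys ! i}"
    using len i le by (auto simp: J_def)
  have X: "{y \<in> set xs. y \<le> xs ! i} = (\<lambda>j. xs ! j) ` J"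
    by (auto simp: J_def in_set_conv_nth)
  have Y: "{y \<in> set ys. y \<le> ys ! i} = (\<lambda>j. ys ! j) ` J"
    by (auto simp: J' in_set_conv_nth)
  define g where "g = (\<lambda>x. ys ! (SOME j. j < length xs \<and> xs ! j = x))"
  have g: "g (xs ! j) = ys ! j" if "j < length xs" for j
  proof -
    have "(SOME k. k < length xs \<and> xs ! k = xs ! j) < length xs \<and>
          xs ! (SOME k. k < length xs \<and> xs ! k = xs ! j) = xs ! j"
      by (rule someI[of _ j]) (simp add: that)
    then show ?thesis
      using eq that unfolding g_def by blast
  qed
  have "bij_betw g ((\<lambda>j. xs ! j) ` J) ((\<lambda>j. ys ! j) ` J)"
    unfolding bij_betw_def
  proof
    show "inj_on g ((\<lambda>j. xs ! j) ` J)"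
      by (auto simp: inj_on_def J_def g eq)
    have "g ` (\<lambda>j. xs ! j) ` J = (\<lambda>j. g (xs ! j)) ` J"
      by (simp add: image_image)
    also have "\<dots> = (\<lambda>j. ys ! j) ` J"
      by (rule image_cong) (auto simp: J_def g)
    finally show "g ` (\<lambda>j. xs ! j) ` J = (\<lambda>j. ys ! j) ` J" .
  qed
  then have "card {y \<in> set xs. y \<le> xs ! i} = card {y \<in> set ys. y \<le> ys ! i}"
    unfolding X Y by (rule bij_betw_same_card)
  then show "standardize xs ! i = standardize ys ! i"
    using i len by (simp add: standardize_def)
qed

lemma standardize_eq_iff: "standardize xs = standardize ys \<longleftrightarrow> order_iso xs ys"
  by (metis order_iso_imp_standardize_eq order_iso_standardize order_iso_sym order_iso_trans)

lemma standardize_permutation: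
  assumes "p \<in> permutations_of_set {1..n}"
  shows "standardize p = p"
proof -
  have "card {y. Suc 0 \<le> y \<and> y \<le> n \<and> y \<le> x} = x" if "x \<le> n" for x
  proof -
    have "{y. Suc 0 \<le> y \<and> y \<le> n \<and> y \<le> x} = {Suc 0..x}" using that by auto
    then show ?thesis by simp
  qed
  then show ?thesis
    using assms by (auto simp: standardize_def permutations_of_set_def conj_assoc intro!: map_idI)
qed

lemma standardize_eq_permutation_iff:
  assumes "p \<in> permutations_of_set {1..n}"
  shows "standardize xs = p \<longleftrightarrow> order_iso xs p"
  using standardize_eq_iff[of xs p] standardize_permutation[OF assms] by simp

lemma order_iso_distinct_iff:
  assumes "order_iso xs ys"
  shows "distinct xs \<longleftrightarrow> distinct ys"
proof -
  have "xs ! i = xs ! j \<longleftrightarrow> ys ! i = ys ! j" if "i < length xs" "j < length xs" for i j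
    using assms that unfolding order_iso_def by (metis antisym order_refl)
  then show ?thesis
    using assms by (auto simp: distinct_conv_nth order_iso_def)
qed

lemma standardize_distinct:
  assumes "distinct xs"
  shows "standardize xs \<in> permutations_of_set {1..length xs}"
proof -
  have d: "distinct (standardize xs)"
    using order_iso_distinct_iff[OF order_iso_standardize] assms by blast
  have sub: "set (standardize xs) \<subseteq> {1..length xs}"
  proof
    fix r assume "r \<in> set (standardize xs)"
    then obtain x where x: "x \<in> set xs" "r = card {y \<in> set xs. y \<le> x}"
      by (auto simp: standardize_def)
    have "card {x} \<le> r" "r \<le> card (set xs)"
      unfolding x(2) using x(1) by (intro card_mono; auto)+
    then show "r \<in> {1..length xs}"
      using card_length[of xs] by simp
  qed
  have "card (set (standardize xs)) = length xs"
    using d by (simp add: distinct_card)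
  then have "set (standardize xs) = {1..length xs}"
    using sub by (intro card_subset_eq) auto
  then show ?thesis
    using d by (simp add: permutations_of_set_def)
qed

lemma order_iso_block:
  assumes "order_iso xs ys"
  shows "order_iso (take k (drop m xs)) (take k (drop m ys))"
  using assms by (auto simp: order_iso_def)

lemma occurrences_standardize: "occurrences \<sigma> (standardize xs) = occurrences \<sigma> xs"
proof -
  have "standardize (take k (drop m (standardize xs))) = standardize (take k (drop m xs))" for k m
    by (rule order_iso_imp_standardize_eq[OF order_iso_block[OF order_iso_standardize]])
  then show ?thesis
    by (simp add: occurrences_def)
qed

section \<open>First occurrences in a sequence and avoiding permutations\<close>

lemma enat_le_first_occurrence:
  "enat m \<le> first_occurrence \<sigma> x \<longleftrightarrow> (\<forall>l<m. l \<notin> seq_occurrences \<sigma> x)"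
  unfolding first_occurrence_def le_INF_iff by (auto simp: not_less[symmetric])

lemma enat_less_first_occurrence:
  "enat m < first_occurrence \<sigma> x \<longleftrightarrow> (\<forall>l\<le>m. l \<notin> seq_occurrences \<sigma> x)"
  using enat_le_first_occurrence[of "Suc m" \<sigma> x] by (simp add: Suc_ile_eq less_Suc_eq_le)

lemma first_occurrence_eq_enat:
  "first_occurrence \<sigma> x = enat m \<longleftrightarrow>
     m \<in> seq_occurrences \<sigma> x \<and> (\<forall>l<m. l \<notin> seq_occurrences \<sigma> x)"
proof -
  have "first_occurrence \<sigma> x = enat m \<longleftrightarrow>
      enat m \<le> first_occurrence \<sigma> x \<and> \<not> enat m < first_occurrence \<sigma> x"
    by auto
  then show ?thesis
    unfolding enat_le_first_occurrence enat_less_first_occurrence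
    by (auto simp: le_less)
qed

lemma first_occurrence_less_iff:
  "first_occurrence \<sigma> x < first_occurrence \<tau> x \<longleftrightarrow>
     (\<exists>m. first_occurrence \<sigma> x = enat m \<and> enat m < first_occurrence \<tau> x)"
  by (cases "first_occurrence \<sigma> x") auto

lemma occurrences_prefix:
  "occurrences \<sigma> (map x [0..<n]) = {m \<in> seq_occurrences \<sigma> x. m + length \<sigma> \<le> n}"
  by (auto simp: occurrences_def seq_occurrences_def drop_map take_map)

text \<open>
This is where the class of avoiding permutations comes from: \<open>\<sigma>\<close> wins with the block starting at
position \<open>m\<close> exactly when the prefix that ends with this block contains no earlier block of either
kind, and occurrences in the prefix depend on its standardization only.
\<close>

lemma standardize_prefix_in_Av_ending_iff:
  assumes "inj x" and len: "length \<tau> = length \<sigma>" and "\<sigma> \<noteq> \<tau>"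
  shows "standardize (map x [0..<m + length \<sigma>]) \<in> Av_ending (m + length \<sigma>) \<sigma> \<tau> \<longleftrightarrow>
    first_occurrence \<sigma> x = enat m \<and> enat m < first_occurrence \<tau> x"
proof -
  have "distinct (map x [0..<m + length \<sigma>])"
    using assms(1) by (auto simp: distinct_map intro: inj_on_subset)
  from standardize_distinct[OF this]
  have "standardize (map x [0..<m + length \<sigma>]) \<in> permutations_of_set {1..m + length \<sigma>}"
    by simp
  then have "standardize (map x [0..<m + length \<sigma>]) \<in> Av_ending (m + length \<sigma>) \<sigma> \<tau> \<longleftrightarrow>
      {l \<in> seq_occurrences \<sigma> x. l \<le> m} = {m} \<and> {l \<in> seq_occurrences \<tau> x. l \<le> m} = {}"
    by (simp add: Av_ending_def occurrences_standardize occurrences_prefix len)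
  also have "{l \<in> seq_occurrences \<sigma> x. l \<le> m} = {m} \<longleftrightarrow> first_occurrence \<sigma> x = enat m"
    unfolding first_occurrence_eq_enat by (auto simp: le_less)
  also have "{l \<in> seq_occurrences \<tau> x. l \<le> m} = {} \<longleftrightarrow> enat m < first_occurrence \<tau> x"
    unfolding enat_less_first_occurrence by auto
  finally show ?thesis .
qed

section \<open>Random sequences without ties\<close>

text \<open>
The distribution of an i.i.d. sequence is a power of the common law, so all probabilities
are computed on the sequence space.
\<close>

locale continuous_law = sequence_space M for M :: "real measure" +
  assumes sets_M: "sets M = sets borel" and no_atoms: "emeasure M {x} = 0"
begin

lemma space_M [simp]: "space M = UNIV"
  using sets_eq_imp_space_eq[OF sets_M] by simp

lemma space_S [simp]: "space S = UNIV"
  by (simp add: space_PiM)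

lemma measurable_coordinate: "(\<lambda>x. x i) \<in> borel_measurable S"
proof -
  have "(\<lambda>x. x i) \<in> measurable S M"
    by (rule measurable_component_singleton) simp
  then show ?thesis
    unfolding measurable_cong_sets[OF refl sets_M] .
qed

lemma pred_standardize_eq: "Measurable.pred S (\<lambda>x. standardize (map x ns) = \<sigma>)"
proof (cases "\<exists>ys::real list. standardize ys = \<sigma>")
  case True
  then obtain ys :: "real list" where ys: "standardize ys = \<sigma>" by blast
  have eq: "(\<lambda>x. standardize (map x ns) = \<sigma>) = (\<lambda>x. length ns = length ys \<and>
      (\<forall>i\<in>{..<length ns}. \<forall>j\<in>{..<length ns}. (x (ns ! i) \<le> x (ns ! j)) = (ys ! i \<le> ys ! j)))"
    unfolding ys[symmetric] standardize_eq_iff by (auto simp: order_iso_def fun_eq_iff)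
  have "Measurable.pred S (\<lambda>x. x i \<le> x j)" for i j
    using borel_measurable_le[OF measurable_coordinate[of i] measurable_coordinate[of j]]
    by (simp add: pred_def)
  then have le: "Measurable.pred S (\<lambda>x. (x i \<le> x j) = c)" for i j c
    by (cases c) simp_all
  have "Measurable.pred S (\<lambda>x. \<forall>i\<in>{..<length ns}. \<forall>j\<in>{..<length ns}.
      (x (ns ! i) \<le> x (ns ! j)) = (ys ! i \<le> ys ! j))"
    by (rule pred_intros_finite(3), simp, rule pred_intros_finite(3), simp, rule le)
  then show ?thesis
    unfolding eq by (cases "length ns = length ys") simp_all
next
  case False
  then have "(\<lambda>x :: nat \<Rightarrow> real. standardize (map x ns) = \<sigma>) = (\<lambda>x. False)" by auto
  then show ?thesis by simp
qed

lemma sets_standardize_in: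
  assumes "finite A"
  shows "{x :: nat \<Rightarrow> real. standardize (map x ns) \<in> A} \<in> sets S"
proof -
  have ev: "{x. standardize (map x ns) = p} \<in> sets S" for p
    using pred_standardize_eq[of ns p] by (simp add: pred_def)
  have eq: "{x :: nat \<Rightarrow> real. standardize (map x ns) \<in> A} = (\<Union>p\<in>A. {x. standardize (map x ns) = p})"
    by auto
  show ?thesis
    unfolding eq using assms ev by (intro sets.finite_UN)
qed

lemma pred_mem_seq_occurrences: "Measurable.pred S (\<lambda>x. m \<in> seq_occurrences \<sigma> x)"
  unfolding seq_occurrences_def mem_Collect_eq by (rule pred_standardize_eq)

lemma pred_no_seq_occurrence:
  "finite I \<Longrightarrow> Measurable.pred S (\<lambda>x. \<forall>l\<in>I. l \<notin> seq_occurrences \<sigma> x)"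
  by (rule pred_intros_finite(3), assumption, rule pred_intros_logic(2), rule pred_mem_seq_occurrences)

lemma pred_first_occurrence_eq: "Measurable.pred S (\<lambda>x. first_occurrence \<sigma> x = enat m)"
  using pred_intros_logic(3)[OF pred_mem_seq_occurrences pred_no_seq_occurrence, of "{..<m}" m \<sigma> \<sigma>]
  by (simp only: first_occurrence_eq_enat lessThan_iff Ball_def finite_lessThan)

lemma pred_less_first_occurrence: "Measurable.pred S (\<lambda>x. enat m < first_occurrence \<sigma> x)"
  using pred_no_seq_occurrence[of "{..m}" \<sigma>]
  by (simp only: enat_less_first_occurrence atMost_iff Ball_def finite_atMost)

lemma sets_first_occurrence_before:
  "{x. first_occurrence \<sigma> x = enat m \<and> enat m < first_occurrence \<tau> x} \<in> sets S"
  using pred_intros_logic(3)[OF pred_first_occurrence_eq pred_less_first_occurrence]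
  by (simp add: pred_def)

lemma pred_first_occurrence_less:
  "Measurable.pred S (\<lambda>x. first_occurrence \<sigma> x < first_occurrence \<tau> x)"
  unfolding first_occurrence_less_iff
  by (intro pred_intros_countable(2) pred_intros_logic(3) pred_first_occurrence_eq
      pred_less_first_occurrence)

lemma distr_reindex:
  assumes "inj f"
  shows "distr S S (\<lambda>x n. x (f n)) = S"
  using distr_PiM_reindex[of UNIV "\<lambda>_. M" f UNIV] assms M.prob_space_axioms
  by (simp add: restrict_UNIV)

lemma measurable_reindex: "(\<lambda>x n. x (f n)) \<in> measurable S S"
  by (rule measurable_PiM_single') (auto intro: measurable_component_singleton)

lemma prob_reindex:
  assumes "inj f" and Q: "Measurable.pred S Q"
  shows "measure S {x. Q (\<lambda>n. x (f n))} = measure S {x. Q x}"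
proof -
  have "measure S {x. Q x} = measure (distr S S (\<lambda>x n. x (f n))) {x \<in> space S. Q x}"
    by (simp add: distr_reindex[OF assms(1)])
  also have "\<dots> = measure S ((\<lambda>x n. x (f n)) -` {x \<in> space S. Q x} \<inter> space S)"
    by (rule measure_distr) (use Q in \<open>simp_all add: measurable_reindex pred_def\<close>)
  finally show ?thesis by (simp add: vimage_def)
qed

text \<open>
Conditioning on the first entry: an i.i.d. sequence is its first entry followed by an independent
copy of the sequence.
\<close>

lemma emeasure_first_entry:
  assumes [measurable]: "Measurable.pred S Q"
  shows "emeasure S {x. Q x} = (\<integral>\<^sup>+a. emeasure S {x. Q (case_nat a x)} \<partial>M)"
proof -
  have [measurable]: "(\<lambda>(a, x). case_nat a x) \<in> measurable (M \<Otimes>\<^sub>M S) S"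
    by measurable
  have [measurable]: "Measurable.pred (M \<Otimes>\<^sub>M S) (\<lambda>z. Q (case_nat (fst z) (snd z)))"
    by measurable
  have "emeasure S {x. Q x} = emeasure (distr (M \<Otimes>\<^sub>M S) S (\<lambda>(a, x). case_nat a x)) {x \<in> space S. Q x}"
    by (simp add: PiM_iter)
  also have "\<dots> = emeasure (M \<Otimes>\<^sub>M S) ((\<lambda>(a, x). case_nat a x) -` {x \<in> space S. Q x} \<inter> space (M \<Otimes>\<^sub>M S))"
    by (rule emeasure_distr) measurable
  also have "(\<lambda>(a, x). case_nat a x) -` {x \<in> space S. Q x} \<inter> space (M \<Otimes>\<^sub>M S) =
      {z \<in> space (M \<Otimes>\<^sub>M S). Q (case_nat (fst z) (snd z))}"
    by (auto simp: space_pair_measure)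
  also have "emeasure (M \<Otimes>\<^sub>M S) \<dots> =
      (\<integral>\<^sup>+a. emeasure S (Pair a -` {z \<in> space (M \<Otimes>\<^sub>M S). Q (case_nat (fst z) (snd z))}) \<partial>M)"
    by (rule P.emeasure_pair_measure_alt) measurable
  finally show ?thesis
    by (simp add: vimage_def space_pair_measure)
qed

lemma prob_first_entry:
  assumes Q [measurable]: "Measurable.pred S Q"
  shows borel_measurable_prob_first_entry:
      "(\<lambda>a. measure S {x. Q (case_nat a x)}) \<in> borel_measurable borel"
    and "measure S {x. Q x} = (\<integral>a. measure S {x. Q (case_nat a x)} \<partial>M)"
proof -
  have "{z \<in> space (M \<Otimes>\<^sub>M S). Q (case_nat (fst z) (snd z))} \<in> sets (M \<Otimes>\<^sub>M S)"
    by measurable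
  then have "(\<lambda>a. emeasure S (Pair a -` {z \<in> space (M \<Otimes>\<^sub>M S). Q (case_nat (fst z) (snd z))}))
      \<in> borel_measurable M"
    by (rule P.measurable_emeasure_Pair)
  then have "(\<lambda>a. emeasure S {x. Q (case_nat a x)}) \<in> borel_measurable M"
    by (simp add: vimage_def space_pair_measure)
  then have m: "(\<lambda>a. measure S {x. Q (case_nat a x)}) \<in> borel_measurable M"
    unfolding measure_def by (rule borel_measurable_enn2real)
  then show "(\<lambda>a. measure S {x. Q (case_nat a x)}) \<in> borel_measurable borel"
    unfolding measurable_cong_sets[OF sets_M refl] .
  have "(\<integral>a. measure S {x. Q (case_nat a x)} \<partial>M) =
      enn2real (\<integral>\<^sup>+a. ennreal (measure S {x. Q (case_nat a x)}) \<partial>M)"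
    using m by (rule integral_eq_nn_integral) simp
  also have "\<dots> = enn2real (emeasure S {x. Q x})"
    using emeasure_first_entry[OF Q] by (simp add: P.emeasure_eq_measure)
  finally show "measure S {x. Q x} = (\<integral>a. measure S {x. Q (case_nat a x)} \<partial>M)"
    by (simp add: measure_def)
qed

text \<open>
By Fubini's theorem a tie between the first two entries has probability zero, because a law
without atoms does not charge the value of the other entry. A tie between any two positions
reduces to this one by reindexing.
\<close>

lemma AE_inj: "AE x in S. inj x"
proof -
  have diff: "AE x in S. x i \<noteq> x j" if "i \<noteq> j" for i j
  proof -
    \<comment> \<open>an injection that moves positions 0 and 1 to \<open>i\<close> and \<open>j\<close>;
      from 2 on its values exceed both\<close>
    define f where "f = (\<lambda>n. if n = 0 then i else if n = Suc 0 then j else n + i + j)"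
    have "inj f"
    proof (rule injI)
      fix k l assume "f k = f l"
      with that show "k = l"
        by (cases "k = 0"; cases "l = 0"; cases "k = Suc 0"; cases "l = Suc 0") (simp_all add: f_def)
    qed
    have sets_eq: "{x. x k = x l} \<in> sets S" for k l
      using borel_measurable_eq[OF measurable_coordinate[of k] measurable_coordinate[of l]] by simp
    have pred_eq: "Measurable.pred S (\<lambda>x. x 0 = x (Suc 0))"
      using sets_eq by (simp add: pred_def)
    have "emeasure S {x. x 0 = x (Suc 0)} = (\<integral>\<^sup>+a. emeasure S {x. a = x 0} \<partial>M)"
      using emeasure_first_entry[OF pred_eq] by simp
    also have "\<dots> = (\<integral>\<^sup>+a. emeasure M {a} \<partial>M)"
    proof (rule nn_integral_cong)
      fix a
      show "emeasure S {x. a = x 0} = emeasure M {a}"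
        using emeasure_PiM_Collect_single[of 0 "{a}"] sets_M by (simp add: eq_commute[of a])
    qed
    also have "\<dots> = 0"
      by (simp add: no_atoms)
    finally have "measure S {x. x 0 = x (Suc 0)} = 0"
      by (simp add: measure_def)
    then have "measure S {x. x i = x j} = 0"
      using prob_reindex[OF \<open>inj f\<close> pred_eq] by (simp add: f_def)
    then show ?thesis
      using sets_eq by (subst AE_iff_measurable[where N="{x. x i = x j}"])
        (simp_all add: P.emeasure_eq_measure)
  qed
  have "AE x in S. \<forall>i j. i \<noteq> j \<longrightarrow> x i \<noteq> x j"
    unfolding AE_all_countable using diff by auto
  then show ?thesis
    by eventually_elim (auto simp: inj_def)
qed

text \<open>
Exchangeability: a rearrangement of positions that turns \<open>p\<close> into \<open>q\<close> preserves the law of the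
sequence. Hence each of the \<open>n!\<close> orderings of a prefix has probability \<open>1/n!\<close>.
\<close>

lemma prob_standardize_prefix_eq:
  assumes p: "p \<in> permutations_of_set {1..n}" and q: "q \<in> permutations_of_set {1..n}"
  shows "measure S {x. standardize (map x [0..<n]) = p} =
         measure S {x. standardize (map x [0..<n]) = q}"
proof -
  have len: "length p = n" "length q = n"
    using length_finite_permutations_of_set[OF p] length_finite_permutations_of_set[OF q] by simp_all
  have "mset q = mset p"
    using p q by (metis permutations_of_setD mset_set_set)
  then obtain f where f: "f permutes {..<length p}" "permute_list f p = q"
    by (rule mset_eq_permutation)
  have q_nth: "q ! i = p ! f i" if "i < n" for i
    using f that len by (auto simp: permute_list_nth)
  have bij: "f ` {..<n} = {..<n}"
    using f(1) len permutes_image by metis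
  have "order_iso (map (\<lambda>i. x (f i)) [0..<n]) q \<longleftrightarrow> order_iso (map x [0..<n]) p" for x :: "nat \<Rightarrow> real"
  proof -
    have "order_iso (map (\<lambda>i. x (f i)) [0..<n]) q \<longleftrightarrow>
        (\<forall>i\<in>{..<n}. \<forall>j\<in>{..<n}. x (f i) \<le> x (f j) \<longleftrightarrow> p ! f i \<le> p ! f j)"
      by (auto simp: order_iso_def len q_nth)
    also have "\<dots> \<longleftrightarrow> (\<forall>i\<in>f ` {..<n}. \<forall>j\<in>f ` {..<n}. x i \<le> x j \<longleftrightarrow> p ! i \<le> p ! j)"
      by blast
    also have "\<dots> \<longleftrightarrow> order_iso (map x [0..<n]) p"
      unfolding bij by (auto simp: order_iso_def len)
    finally show ?thesis .
  qed
  then have "{x. standardize (map x [0..<n]) = p} =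
      {x :: nat \<Rightarrow> real. standardize (map (\<lambda>i. x (f i)) [0..<n]) = q}"
    by (simp add: standardize_eq_permutation_iff[OF p] standardize_eq_permutation_iff[OF q])
  also have "measure S \<dots> = measure S {x. standardize (map x [0..<n]) = q}"
    using f(1) by (intro prob_reindex[where Q="\<lambda>x. standardize (map x [0..<n]) = q"])
      (auto simp: permutes_inj intro: pred_standardize_eq)
  finally show ?thesis .
qed

lemma prob_standardize_prefix_in:
  assumes A: "A \<subseteq> permutations_of_set {1..n}"
  shows "measure S {x. standardize (map x [0..<n]) \<in> A} = card A / fact n"
proof -
  let ?R = "\<lambda>x. standardize (map x [0..<n])"
  let ?P = "permutations_of_set {1..n}"
  have sum: "measure S {x. ?R x \<in> B} = (\<Sum>p\<in>B. measure S {x. ?R x = p})" if "B \<subseteq> ?P" for B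
  proof -
    have "measure S (\<Union>p\<in>B. {x. ?R x = p}) = (\<Sum>p\<in>B. measure S {x. ?R x = p})"
    proof (rule P.finite_measure_finite_Union)
      show "finite B" using that by (rule finite_subset) simp
      show "(\<lambda>p. {x. ?R x = p}) ` B \<subseteq> P.events"
        using pred_standardize_eq by (auto simp: pred_def)
    qed (auto simp: disjoint_family_on_def)
    also have "(\<Union>p\<in>B. {x. ?R x = p}) = {x. ?R x \<in> B}" by auto
    finally show ?thesis .
  qed
  obtain q where q: "q \<in> ?P"
    using permutations_of_set_nonempty by fastforce
  define c where "c = measure S {x. ?R x = q}"
  have c: "measure S {x. ?R x = p} = c" if "p \<in> ?P" for p
    unfolding c_def using prob_standardize_prefix_eq[OF that q] .
  have "AE x in S. ?R x \<in> ?P"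
    using AE_inj
  proof eventually_elim
    case (elim x)
    then have "distinct (map x [0..<n])"
      by (auto simp: distinct_map intro: inj_on_subset)
    from standardize_distinct[OF this] show ?case by simp
  qed
  moreover have "{x. ?R x \<in> ?P} \<in> sets S"
    by (rule sets_standardize_in) simp
  ultimately have "measure S {x. ?R x \<in> ?P} = 1"
    by (subst P.prob_eq_1) auto
  with sum[OF order_refl] have "real (card ?P) * c = 1"
    by (simp add: c)
  then have "c = 1 / fact n"
    by (simp add: field_simps)
  moreover have "measure S {x. ?R x \<in> A} = card A * c"
    using sum[OF A] c A by (simp add: subset_eq)
  ultimately show ?thesis by simp
qed

lemma prob_first_occurrence_before:
  assumes "length \<tau> = length \<sigma>" and "\<sigma> \<noteq> \<tau>"
  shows "measure S {x. first_occurrence \<sigma> x = enat m \<and> enat m < first_occurrence \<tau> x} =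
         card (Av_ending (m + length \<sigma>) \<sigma> \<tau>) / fact (m + length \<sigma>)"
proof -
  let ?n = "m + length \<sigma>"
  have A: "Av_ending ?n \<sigma> \<tau> \<subseteq> permutations_of_set {1..?n}"
    by (auto simp: Av_ending_def)
  have m: "{x. standardize (map x [0..<?n]) \<in> Av_ending ?n \<sigma> \<tau>} \<in> sets S"
    using finite_subset[OF A] by (intro sets_standardize_in) simp
  have "measure S {x. first_occurrence \<sigma> x = enat m \<and> enat m < first_occurrence \<tau> x} =
      measure S {x. standardize (map x [0..<?n]) \<in> Av_ending ?n \<sigma> \<tau>}"
  proof (rule P.finite_measure_eq_AE[OF _ sets_first_occurrence_before m])
    show "AE x in S. x \<in> {x. first_occurrence \<sigma> x = enat m \<and> enat m < first_occurrence \<tau> x} \<longleftrightarrow>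
        x \<in> {x. standardize (map x [0..<?n]) \<in> Av_ending ?n \<sigma> \<tau>}"
      using AE_inj by eventually_elim (simp add: standardize_prefix_in_Av_ending_iff assms)
  qed
  then show ?thesis
    unfolding prob_standardize_prefix_in[OF A] .
qed

text \<open>
The event splits according to the position of the winning block. A block at position \<open>m\<close> ends a
prefix of length \<open>n = m + length \<sigma>\<close>, so the index \<open>n\<close> starts at \<open>length \<sigma>\<close>.
\<close>

lemma has_sum_prob_before:
  assumes "length \<tau> = length \<sigma>" and "\<sigma> \<noteq> \<tau>"
  shows "((\<lambda>n. card (Av_ending n \<sigma> \<tau>) / fact n) has_sum
          measure S {x. first_occurrence \<sigma> x < first_occurrence \<tau> x}) {length \<sigma>..}"
proof -
  let ?k = "length \<sigma>"
  define E where "E = (\<lambda>m. {x :: nat \<Rightarrow> real.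
    first_occurrence \<sigma> x = enat m \<and> enat m < first_occurrence \<tau> x})"
  have "range E \<subseteq> sets S"
    using sets_first_occurrence_before by (auto simp: E_def)
  moreover have "disjoint_family E"
    by (auto simp: disjoint_family_on_def E_def)
  ultimately have "(\<lambda>m. measure S (E m)) sums measure S (\<Union>m. E m)"
    by (rule P.finite_measure_UNION)
  also have "(\<Union>m. E m) = {x. first_occurrence \<sigma> x < first_occurrence \<tau> x}"
    unfolding first_occurrence_less_iff by (auto simp: E_def)
  finally have "((\<lambda>m. measure S (E m)) has_sum
      measure S {x. first_occurrence \<sigma> x < first_occurrence \<tau> x}) UNIV"
    by (intro sums_nonneg_imp_has_sum) auto
  also have "(\<lambda>m. measure S (E m)) = (\<lambda>n. card (Av_ending n \<sigma> \<tau>) / fact n) \<circ> (\<lambda>m. m + ?k)"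
    using prob_first_occurrence_before[OF assms] by (auto simp: E_def)
  finally have "((\<lambda>n. card (Av_ending n \<sigma> \<tau>) / fact n) has_sum
      measure S {x. first_occurrence \<sigma> x < first_occurrence \<tau> x}) (range (\<lambda>m. m + ?k))"
    by (subst has_sum_reindex) (auto simp: inj_on_def comp_def)
  also have "range (\<lambda>m. m + ?k) = {?k..}"
    by (auto simp: image_iff le_iff_add add.commute)
  finally show ?thesis .
qed

end

lemma iid_law:
  assumes iid: "iid_continuous M X"
  defines "\<mu> \<equiv> distr M borel (X 0)"
  shows "continuous_law \<mu>"
    and "prob_before M X \<sigma> \<tau> =
      measure (\<Pi>\<^sub>M i\<in>UNIV. \<mu>) {x. first_occurrence \<sigma> x < first_occurrence \<tau> x}"
proof -
  from iid interpret prob_space M by (simp add: iid_continuous_def)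
  from iid have ind: "indep_vars (\<lambda>_. borel) X UNIV"
    and same: "distr M borel (X n) = \<mu>" for n
    by (auto simp: iid_continuous_def \<mu>_def)
  have rv [measurable]: "random_variable borel (X n)" for n
    using ind by (auto simp: indep_vars_def)
  have eq: "distr M (\<Pi>\<^sub>M i\<in>UNIV. borel) (\<lambda>\<omega> n. X n \<omega>) = (\<Pi>\<^sub>M i\<in>UNIV. \<mu>)"
    using ind indep_vars_iff_distr_eq_PiM[where I=UNIV and M'="\<lambda>_. borel" and X=X]
    by (simp add: same restrict_UNIV)
  interpret \<mu>: real_distribution \<mu>
    unfolding \<mu>_def by (rule real_distribution_distr) simp
  interpret sequence_space \<mu>
    by unfold_locales
  show law: "continuous_law \<mu>"
  proof unfold_locales
    fix x
    have "isCont (cdf \<mu>) x"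
      using iid by (simp add: iid_continuous_def \<mu>_def continuous_on_eq_continuous_at)
    then show "emeasure \<mu> {x} = 0"
      by (simp add: \<mu>.isCont_cdf \<mu>.emeasure_eq_measure)
  qed simp
  interpret continuous_law \<mu> by (fact law)
  have sets: "sets S = sets (\<Pi>\<^sub>M i\<in>(UNIV::nat set). borel)"
    by (intro sets_PiM_cong) (simp_all add: \<mu>_def)
  have ev: "{x. first_occurrence \<sigma> x < first_occurrence \<tau> x} \<in> sets S"
    using pred_first_occurrence_less[of \<sigma> \<tau>] by (simp add: pred_def)
  have "measure S {x. first_occurrence \<sigma> x < first_occurrence \<tau> x} = measure M
      ((\<lambda>\<omega> n. X n \<omega>) -` {x. first_occurrence \<sigma> x < first_occurrence \<tau> x} \<inter> space M)"
    unfolding eq[symmetric]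
  proof (rule measure_distr)
    show "(\<lambda>\<omega> n. X n \<omega>) \<in> M \<rightarrow>\<^sub>M Pi\<^sub>M UNIV (\<lambda>i. borel)"
      by (rule measurable_PiM_single') auto
  qed (use ev sets in simp)
  then show "prob_before M X \<sigma> \<tau> = measure S {x. first_occurrence \<sigma> x < first_occurrence \<tau> x}"
    by (simp add: prob_before_def vimage_def Int_def conj_commute)
qed

lemma sum_t_count:
  assumes "n \<ge> 2"
  shows "(\<Sum>i=1..n. \<Sum>j\<in>{1..n} - {i}. t_count n i j) = card (Av_ending n [1, 2, 3] [3, 1, 2])"
proof -
  let ?A = "Av_ending n [1, 2, 3] [3, 1, 2]"
  let ?I = "SIGMA i:{1..n}. {1..n} - {i}"
  let ?B = "\<lambda>(i, j). {p \<in> ?A. p ! 0 = i \<and> p ! 1 = j}"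
  have fin: "finite ?A"
    by (rule finite_subset[of _ "permutations_of_set {1..n}"]) (auto simp: Av_ending_def)
  have "(\<Sum>i=1..n. \<Sum>j\<in>{1..n} - {i}. t_count n i j) = (\<Sum>z\<in>?I. card (?B z))"
    by (subst sum.Sigma) (auto simp: t_count_def intro!: sum.cong)
  also have "\<dots> = card (\<Union>z\<in>?I. ?B z)"
    using fin by (intro card_UN_disjoint[symmetric]) (auto intro: finite_subset)
  also have "(\<Union>z\<in>?I. ?B z) = ?A"
  proof (intro equalityI subsetI)
    fix p assume p: "p \<in> ?A"
    then have P: "p \<in> permutations_of_set {1..n}" by (simp add: Av_ending_def)
    then have len: "length p = n" and set: "set p = {1..n}" and "distinct p"
      using length_finite_permutations_of_set[OF P] permutations_of_setD[OF P] by simp_all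
    then have "p ! 0 \<in> {1..n}" "p ! 1 \<in> {1..n}" "p ! 0 \<noteq> p ! 1"
      using assms unfolding set[symmetric] by (simp_all add: nth_eq_iff_index_eq)
    with p show "p \<in> (\<Union>z\<in>?I. ?B z)" by auto
  qed auto
  finally show ?thesis .
qed

section \<open>The race between 123 and 312\<close>

definition wins :: "(nat \<Rightarrow> real) \<Rightarrow> bool" where
  "wins x \<longleftrightarrow> first_occurrence [1, 2, 3] x < first_occurrence [3, 1, 2] x"

lemma Suc_mem_seq_occurrences:
  "Suc m \<in> seq_occurrences \<sigma> (case_nat a x) \<longleftrightarrow> m \<in> seq_occurrences \<sigma> x"
proof -
  have "map (case_nat a x) [Suc m..<Suc m + length \<sigma>] =
      map (case_nat a x) (map Suc [m..<m + length \<sigma>])"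
    by (simp only: map_Suc_upt add_Suc)
  also have "\<dots> = map x [m..<m + length \<sigma>]"
    by simp
  finally show ?thesis
    by (simp add: seq_occurrences_def)
qed

text \<open>
The recursion behind the numerical part: the race is decided by the first block, or else it is
the race in the shifted sequence.
\<close>

lemma first_occurrence_less_case_nat:
  "first_occurrence \<sigma> (case_nat a x) < first_occurrence \<tau> (case_nat a x) \<longleftrightarrow>
    0 \<notin> seq_occurrences \<tau> (case_nat a x) \<and>
    (0 \<in> seq_occurrences \<sigma> (case_nat a x) \<or> first_occurrence \<sigma> x < first_occurrence \<tau> x)"
proof -
  have before_iff: "first_occurrence \<sigma> z < first_occurrence \<tau> z \<longleftrightarrow>
      (\<exists>m. m \<in> seq_occurrences \<sigma> z \<and> (\<forall>l<Suc m. l \<notin> seq_occurrences \<tau> z))" for z :: "nat \<Rightarrow> 'a"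
  proof
    assume "first_occurrence \<sigma> z < first_occurrence \<tau> z"
    then show "\<exists>m. m \<in> seq_occurrences \<sigma> z \<and> (\<forall>l<Suc m. l \<notin> seq_occurrences \<tau> z)"
      unfolding first_occurrence_less_iff first_occurrence_eq_enat enat_less_first_occurrence
      by (auto simp: less_Suc_eq_le)
  next
    assume "\<exists>m. m \<in> seq_occurrences \<sigma> z \<and> (\<forall>l<Suc m. l \<notin> seq_occurrences \<tau> z)"
    then obtain m where m: "m \<in> seq_occurrences \<sigma> z" "\<forall>l<Suc m. l \<notin> seq_occurrences \<tau> z" by blast
    then have "first_occurrence \<sigma> z \<le> enat m"
      unfolding first_occurrence_def by (intro INF_lower)
    also have "enat m < first_occurrence \<tau> z"
      unfolding enat_less_first_occurrence using m by (auto simp: less_Suc_eq_le)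
    finally show "first_occurrence \<sigma> z < first_occurrence \<tau> z" .
  qed
  have ex: "(\<exists>m. R m) \<longleftrightarrow> R 0 \<or> (\<exists>m. R (Suc m))" for R :: "nat \<Rightarrow> bool"
    by (metis not0_implies_Suc)
  show ?thesis
    unfolding before_iff ex[of "\<lambda>m. m \<in> seq_occurrences \<sigma> (case_nat a x) \<and> _ m"]
      All_less_Suc2 Suc_mem_seq_occurrences
    by auto
qed

lemma standardize_eq_123: "standardize [a, b, c] = [1, 2, 3] \<longleftrightarrow> a < b \<and> b < c"
proof -
  have "[1, 2, 3] \<in> permutations_of_set {1..3::nat}"
    by (auto simp: permutations_of_set_def)
  from standardize_eq_permutation_iff[OF this, of "[a, b, c]"] show ?thesis
    by (auto simp: order_iso_def All_less_Suc numeral_3_eq_3)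
qed

lemma standardize_eq_312: "standardize [a, b, c] = [3, 1, 2] \<longleftrightarrow> b < c \<and> c < a"
proof -
  have "[3, 1, 2] \<in> permutations_of_set {1..3::nat}"
    by (auto simp: permutations_of_set_def)
  from standardize_eq_permutation_iff[OF this, of "[a, b, c]"] show ?thesis
    by (auto simp: order_iso_def All_less_Suc numeral_3_eq_3)
qed

lemma wins_case_nat:
  "wins (case_nat a (case_nat b (case_nat c x))) \<longleftrightarrow>
    a < b \<and> b < c \<or> \<not> (b < c \<and> c < a) \<and> wins (case_nat b (case_nat c x))"
proof -
  have upt: "[0..<3] = [0, 1, 2]"
    by (simp add: numeral_3_eq_3 numeral_2_eq_2)
  have "0 \<in> seq_occurrences [1, 2, 3] (case_nat a (case_nat b (case_nat c x))) \<longleftrightarrow> a < b \<and> b < c"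
       "0 \<in> seq_occurrences [3, 1, 2] (case_nat a (case_nat b (case_nat c x))) \<longleftrightarrow> b < c \<and> c < a"
    using standardize_eq_123[of a b c] standardize_eq_312[of a b c]
    by (simp_all add: seq_occurrences_def upt numeral_2_eq_2)
  moreover have "\<not> (a < b \<and> b < c \<and> c < a)"
    by auto
  ultimately show ?thesis
    unfolding wins_def by (subst first_occurrence_less_case_nat) blast
qed

section \<open>The uniform law\<close>

definition U :: "real measure" where
  "U = uniform_measure lborel {0..1}"

lemma U_eq_density: "U = density lborel (\<lambda>c. ennreal (indicator {0..1} c))"
  unfolding U_def uniform_measure_def by (intro density_cong) (auto simp: indicator_def)

lemma sets_U [simp, measurable_cong]: "sets U = sets borel"
  by (simp add: U_def)

lemma prob_space_U: "prob_space U"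
  unfolding U_def by (rule prob_space_uniform_measure) auto

lemma continuous_law_U: "continuous_law U"
proof -
  interpret prob_space U by (rule prob_space_U)
  interpret sequence_space U by unfold_locales
  show ?thesis
  proof
    fix x :: real
    have "emeasure U {x} = emeasure lborel ({0..1} \<inter> {x}) / emeasure lborel {0..1::real}"
      unfolding U_def by (rule emeasure_uniform_measure) auto
    also have "emeasure lborel ({0..1} \<inter> {x}) = 0"
      using emeasure_lborel_countable[of "{0..1} \<inter> {x}"] by simp
    finally show "emeasure U {x} = 0" by simp
  qed simp
qed

interpretation U: continuous_law U
  by (rule continuous_law_U)

lemma AE_U: "AE c in U. c \<in> {0..1}"
  unfolding U_def by (rule AE_uniform_measureI) auto

lemma AE_U_neq: "AE c in U. c \<noteq> x"
  by (rule AE_I[of _ _ "{x}"]) (auto simp: U.no_atoms)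

lemma integral_U:
  fixes f :: "real \<Rightarrow> real"
  assumes "f \<in> borel_measurable borel"
  shows "(\<integral>c. f c \<partial>U) = (\<integral>c. indicator {0..1} c * f c \<partial>lborel)"
  unfolding U_eq_density by (rule integral_real_density) (simp_all add: assms)

lemma integrable_U:
  fixes f :: "real \<Rightarrow> real"
  assumes "f \<in> borel_measurable borel" "\<And>c. c \<in> {0..1} \<Longrightarrow> \<bar>f c\<bar> \<le> K"
  shows "integrable U f"
proof (rule U.M.integrable_const_bound[where B=K])
  show "AE c in U. norm (f c) \<le> K"
    using AE_U by eventually_elim (use assms(2) in simp)
  show "f \<in> borel_measurable U"
    unfolding measurable_cong_sets[OF sets_U refl] by (rule assms(1))
qed

lemma prob_U_greater:
  assumes "b \<in> {0..1}"
  shows "measure U {b<..} = 1 - b"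
proof -
  have "measure U {b<..} = measure lborel ({0..1} \<inter> {b<..}) / measure lborel {0..1::real}"
    unfolding U_def by (rule measure_uniform_measure) auto
  also have "{0..1} \<inter> {b<..} = {b<..1}"
    using assms by auto
  finally show ?thesis
    using assms by simp
qed

section \<open>The transition operator\<close>

text \<open>
The operator of one more step, restricted to the steps that do not end the race: the two latest
entries are \<open>a\<close> and \<open>b\<close>, and the next entry \<open>c\<close> is uniform. A tie \<open>a = b\<close> is a state in which no entry
\<open>c\<close> ends the race. So \<open>(a, a)\<close> also stands for a race of which only the first entry \<open>a\<close> is known.
\<close>

definition continue :: "(real \<Rightarrow> real \<Rightarrow> real) \<Rightarrow> real \<Rightarrow> real \<Rightarrow> real" where
  "continue h a b = (\<integral>c. (if a < b \<and> b < c \<or> b < c \<and> c < a then 0 else h b c) \<partial>U)"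

definition win :: "real \<Rightarrow> real \<Rightarrow> real" where
  "win a b = measure U.S {x. wins (case_nat a (case_nat b x))}"

lemma pred_wins: "Measurable.pred U.S wins"
  unfolding wins_def[abs_def] by (rule U.pred_first_occurrence_less)

lemma pred_case_nat:
  assumes "Measurable.pred U.S Q"
  shows "Measurable.pred U.S (\<lambda>x. Q (case_nat a x))"
proof -
  have "(\<lambda>x. case_nat a x) \<in> measurable U.S U.S"
  proof (rule measurable_PiM_single')
    show "(\<lambda>x. case_nat a x i) \<in> measurable U.S U" for i
      by (cases i) (auto intro: measurable_component_singleton)
  qed auto
  from measurable_compose[OF this assms] show ?thesis .
qed

lemma borel_measurable_win: "win a \<in> borel_measurable borel"
  unfolding win_def by (rule U.borel_measurable_prob_first_entry[OF pred_case_nat[OF pred_wins]])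

lemma win_bounds: "0 \<le> win a b" "win a b \<le> 1"
  by (simp_all add: win_def)

lemma integrable_continue:
  fixes K :: real
  assumes "\<And>b. h b \<in> borel_measurable borel"
    and "\<And>b c. b \<in> {0..1} \<Longrightarrow> c \<in> {0..1} \<Longrightarrow> \<bar>h b c\<bar> \<le> K" and "b \<in> {0..1}"
  shows "integrable U (\<lambda>c. if a < b \<and> b < c \<or> b < c \<and> c < a then 0 else h b c)"
proof (rule integrable_U[where K=K])
  define B where "B = (if a < b then {b<..} else {}) \<union> {b<..<a}"
  have "(\<lambda>c. indicat_real (- B) c * h b c) \<in> borel_measurable borel"
    by (intro borel_measurable_times borel_measurable_indicator assms(1)) (simp add: B_def)
  also have "(\<lambda>c. indicat_real (- B) c * h b c) =
      (\<lambda>c. if a < b \<and> b < c \<or> b < c \<and> c < a then 0 else h b c)"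
    by (auto simp: B_def indicator_def fun_eq_iff)
  finally show "(\<lambda>c. if a < b \<and> b < c \<or> b < c \<and> c < a then 0 else h b c) \<in> borel_measurable borel" .
  fix c :: real assume "c \<in> {0..1}"
  with assms(2)[OF assms(3) this]
  show "\<bar>if a < b \<and> b < c \<or> b < c \<and> c < a then 0 else h b c\<bar> \<le> K"
    by auto
qed

text \<open>
The probability that the race is won at once is \<open>1 - b\<close> after an ascent to \<open>b\<close> and \<open>0\<close> otherwise.
\<close>

lemma win_eq:
  assumes "b \<in> {0..1}"
  shows "win a b = (if a < b then 1 - b else 0) + continue win a b"
proof -
  have "win a b = (\<integral>c. measure U.S {x. wins (case_nat a (case_nat b (case_nat c x)))} \<partial>U)"
    unfolding win_def by (rule U.prob_first_entry[OF pred_case_nat[OF pred_case_nat[OF pred_wins]]])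
  also have "\<dots> = (\<integral>c. (if a < b then indicat_real {b<..} c else 0) +
      (if a < b \<and> b < c \<or> b < c \<and> c < a then 0 else win b c) \<partial>U)"
  proof (intro Bochner_Integration.integral_cong refl)
    fix c
    have "measure U.S UNIV = 1"
      using U.P.prob_space by simp
    then show "measure U.S {x. wins (case_nat a (case_nat b (case_nat c x)))} =
        (if a < b then indicat_real {b<..} c else 0) +
        (if a < b \<and> b < c \<or> b < c \<and> c < a then 0 else win b c)"
      by (cases "a < b"; cases "b < c"; cases "c < a") (simp_all add: wins_case_nat win_def)
  qed
  also have "\<dots> = (\<integral>c. (if a < b then indicat_real {b<..} c else 0) \<partial>U) + continue win a b"
    unfolding continue_def
  proof (rule Bochner_Integration.integral_add)
    show "integrable U (\<lambda>c. if a < b then indicat_real {b<..} c else 0)"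
      by (rule integrable_U[where K=1]) simp_all
    show "integrable U (\<lambda>c. if a < b \<and> b < c \<or> b < c \<and> c < a then 0 else win b c)"
      by (rule integrable_continue[where K=1])
        (simp_all only: borel_measurable_win abs_of_nonneg win_bounds assms)
  qed
  also have "(\<integral>c. (if a < b then indicat_real {b<..} c else 0) \<partial>U) = (if a < b then 1 - b else 0)"
    by (cases "a < b") (simp_all add: prob_U_greater[OF assms])
  finally show ?thesis .
qed

lemma prob_wins_first_entry:
  assumes "a \<in> {0..1}"
  shows "measure U.S {x. wins (case_nat a x)} = win a a"
proof -
  have "measure U.S {x. wins (case_nat a x)} = (\<integral>b. win a b \<partial>U)"
    unfolding win_def by (rule U.prob_first_entry[OF pred_case_nat[OF pred_wins]])
  also have "\<dots> = continue win a a"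
    unfolding continue_def by (intro Bochner_Integration.integral_cong) auto
  also have "\<dots> = win a a"
    using win_eq[OF assms, of a] by simp
  finally show ?thesis .
qed

section \<open>Comparison of value functions\<close>

lemma continue_add:
  assumes "\<And>b. h b \<in> borel_measurable borel" "\<And>b. k b \<in> borel_measurable borel"
    and "\<And>b c. b \<in> {0..1} \<Longrightarrow> c \<in> {0..1} \<Longrightarrow> \<bar>h b c\<bar> \<le> H"
    and "\<And>b c. b \<in> {0..1} \<Longrightarrow> c \<in> {0..1} \<Longrightarrow> \<bar>k b c\<bar> \<le> K" and "b \<in> {0..1}"
  shows "continue (\<lambda>b c. h b c + k b c) a b = continue h a b + continue k a b"
  unfolding continue_def
  using Bochner_Integration.integral_add[OF
      integrable_continue[where h=h and K=H and a=a and b=b] integrable_continue[where h=k and K=K and a=a and b=b]] assms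
  by (simp cong: if_cong add: if_distrib[of "\<lambda>x. x + _"])

lemma continue_mult: "continue (\<lambda>b c. r * h b c) a b = r * continue h a b"
proof -
  have "continue (\<lambda>b c. r * h b c) a b =
      (\<integral>c. r * (if a < b \<and> b < c \<or> b < c \<and> c < a then 0 else h b c) \<partial>U)"
    unfolding continue_def by (intro Bochner_Integration.integral_cong) auto
  then show ?thesis
    by (simp add: continue_def)
qed

lemma continue_mono:
  assumes "\<And>b. h b \<in> borel_measurable borel" "\<And>b. k b \<in> borel_measurable borel"
    and "\<And>b c. b \<in> {0..1} \<Longrightarrow> c \<in> {0..1} \<Longrightarrow> \<bar>h b c\<bar> \<le> H"
    and "\<And>b c. b \<in> {0..1} \<Longrightarrow> c \<in> {0..1} \<Longrightarrow> \<bar>k b c\<bar> \<le> K"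
    and le: "\<And>b c. b \<in> {0..1} \<Longrightarrow> c \<in> {0..1} \<Longrightarrow> h b c \<le> k b c" and b: "b \<in> {0..1}"
  shows "continue h a b \<le> continue k a b"
  unfolding continue_def
proof (rule integral_mono_AE)
  show "integrable U (\<lambda>c. if a < b \<and> b < c \<or> b < c \<and> c < a then 0 else h b c)"
    by (rule integrable_continue[where K=H]) (use assms in auto)
  show "integrable U (\<lambda>c. if a < b \<and> b < c \<or> b < c \<and> c < a then 0 else k b c)"
    by (rule integrable_continue[where K=K]) (use assms in auto)
  show "AE c in U. (if a < b \<and> b < c \<or> b < c \<and> c < a then 0 else h b c) \<le>
      (if a < b \<and> b < c \<or> b < c \<and> c < a then 0 else k b c)"
    using AE_U by eventually_elim (use le[OF b] in auto)
qed

text \<open>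
The shape of the solutions of \<open>h = \<kappa> p + continue h\<close>, where \<open>p\<close> is the probability of winning at once.
After an ascent to \<open>b\<close> only \<open>b\<close> matters: let \<open>A b\<close> be the value. After a descent from \<open>a\<close> to \<open>b\<close> an entry
below \<open>b\<close> leads to the same states as after an ascent to \<open>b\<close>, and this part contributes \<open>A b\<close> without the
immediate gain \<open>\<kappa> (1 - b)\<close>. An entry above \<open>a\<close> is a new ascent, and this part contributes the integral
of \<open>A\<close> from \<open>a\<close> to \<open>1\<close>. With \<open>C s\<close> for the integral of \<open>A\<close> from \<open>1 - s\<close> to \<open>1\<close> and \<open>C'\<close> for its
derivative, \<open>A b = C' (1 - b)\<close>. With \<open>\<kappa> = 0\<close> the same shape describes the expected length of
the race, where each step costs \<open>1\<close>.
\<close>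

definition reward :: "real \<Rightarrow> (real \<Rightarrow> real) \<Rightarrow> (real \<Rightarrow> real) \<Rightarrow> real \<Rightarrow> real \<Rightarrow> real" where
  "reward \<kappa> C C' a b = C' (1 - b) - (if a < b then 0 else \<kappa> * (1 - b) - C (1 - a))"

lemma integrable_indicator_Icc:
  fixes g :: "real \<Rightarrow> real"
  assumes "continuous_on {u..v} g"
  shows "integrable lborel (\<lambda>c. indicator {u..v} c * g c)"
  using borel_integrable_atLeastAtMost'[OF assms] by (simp add: set_integrable_def)

lemma integral_indicator_Icc_FTC:
  fixes g G :: "real \<Rightarrow> real"
  assumes "u \<le> v" "continuous_on {u..v} g" "\<And>c. (G has_real_derivative g c) (at c)"
  shows "(\<integral>c. indicator {u..v} c * g c \<partial>lborel) = G v - G u"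
  using integral_FTC_atLeastAtMost[OF assms(1) _ assms(2), of G] assms(3)
  by (simp add: has_real_derivative_iff_has_vector_derivative has_vector_derivative_at_within)

locale potential =
  fixes C C' :: "real \<Rightarrow> real"
  assumes deriv: "\<And>s. (C has_real_derivative C' s) (at s)"
    and cont: "continuous_on UNIV C'" and C_0: "C 0 = 0"
begin

lemma cont_C: "continuous_on UNIV C"
  using deriv by (auto intro!: continuous_at_imp_continuous_on DERIV_isCont)

lemma borel_measurable_reward: "reward \<kappa> C C' a \<in> borel_measurable borel"
proof -
  have "(\<lambda>b. C' (1 - b)) \<in> borel_measurable borel"
    by (intro borel_measurable_continuous_onI continuous_on_compose2[OF cont] continuous_intros) auto
  moreover have "(\<lambda>b. indicat_real {..a} b * (\<kappa> * (1 - b) - C (1 - a))) \<in> borel_measurable borel"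
  proof (rule borel_measurable_times)
    show "indicat_real {..a} \<in> borel_measurable borel"
      by (rule borel_measurable_indicator) simp
    show "(\<lambda>b. \<kappa> * (1 - b) - C (1 - a)) \<in> borel_measurable borel"
      by (intro borel_measurable_continuous_onI continuous_intros)
  qed
  ultimately have "(\<lambda>b. C' (1 - b) - indicat_real {..a} b * (\<kappa> * (1 - b) - C (1 - a)))
      \<in> borel_measurable borel"
    by (rule borel_measurable_diff)
  also have "(\<lambda>b. C' (1 - b) - indicat_real {..a} b * (\<kappa> * (1 - b) - C (1 - a))) = reward \<kappa> C C' a"
    by (auto simp: reward_def indicator_def fun_eq_iff)
  finally show ?thesis .
qed

lemma reward_bounded:
  obtains K where "\<And>a b. a \<in> {0..1} \<Longrightarrow> b \<in> {0..1} \<Longrightarrow> \<bar>reward \<kappa> C C' a b\<bar> \<le> K"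
proof -
  have "bounded (C ` {0..1})" "bounded (C' ` {0..1})"
    using cont cont_C by (meson compact_Icc compact_continuous_image compact_imp_bounded
        continuous_on_subset subset_UNIV)+
  then obtain K K' where K: "\<And>s. s \<in> {0..1} \<Longrightarrow> \<bar>C s\<bar> \<le> K" "\<And>s. s \<in> {0..1} \<Longrightarrow> \<bar>C' s\<bar> \<le> K'"
    unfolding bounded_iff by (metis imageI real_norm_def)
  show thesis
  proof (rule that)
    fix a b :: real assume ab: "a \<in> {0..1}" "b \<in> {0..1}"
    have "\<bar>\<kappa> * (1 - b)\<bar> \<le> \<bar>\<kappa>\<bar> * 1"
      unfolding abs_mult using ab by (intro mult_left_mono) auto
    with K(1)[of "1 - a"] K(2)[of "1 - b"] ab
    show "\<bar>reward \<kappa> C C' a b\<bar> \<le> K' + (\<bar>\<kappa>\<bar> + K)"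
      unfolding reward_def by (auto split: if_splits)
  qed
qed

text \<open>
The integrals over \<open>c < b\<close> and \<open>c > a\<close> have explicit antiderivatives. In the variable \<open>s = 1 - b\<close> the
equation \<open>h = \<kappa> p + continue h\<close> thus becomes a linear first-order differential equation for \<open>C\<close>.
\<close>

lemma continue_reward:
  assumes a: "a \<in> {0..1}" and b: "b \<in> {0..1}"
  shows "continue (reward \<kappa> C C') a b =
    C 1 - (1 - b) * C (1 - b) - \<kappa> * (1 - (1 - b)\<^sup>2) / 2 + (if a < b then 0 else C (1 - a))"
proof -
  define f where "f = (\<lambda>c. C' (1 - c) - \<kappa> * (1 - c) + C (1 - b))"
  define F where "F = (\<lambda>c. - C (1 - c) + \<kappa> * (1 - c)\<^sup>2 / 2 + c * C (1 - b))"
  have contC': "continuous_on A (\<lambda>c. C' (1 - c))" for A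
    by (intro continuous_on_compose2[OF cont] continuous_intros) auto
  have contf: "continuous_on A f" for A
    unfolding f_def by (intro continuous_intros contC')
  have dC: "((\<lambda>c. - C (1 - c)) has_real_derivative C' (1 - c)) (at c)" for c
    by (rule derivative_eq_intros DERIV_chain2[OF deriv] refl | simp)+
  have dF: "(F has_real_derivative f c) (at c)" for c
  proof -
    have "((\<lambda>c. \<kappa> * (1 - c)\<^sup>2 / 2 + c * C (1 - b)) has_real_derivative
        - \<kappa> * (1 - c) + C (1 - b)) (at c)"
      by (auto intro!: derivative_eq_intros simp: field_simps)
    from DERIV_add[OF dC this] show ?thesis
      by (simp add: F_def f_def algebra_simps)
  qed
  define k where "k = (\<lambda>c. indicator {0..b} c * f c + (if a < b then 0 else indicator {a..1} c * C' (1 - c)))"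
  have k: "k \<in> borel_measurable borel"
    unfolding k_def
    using borel_measurable_integrable[OF integrable_indicator_Icc[OF contf]] borel_measurable_integrable[OF integrable_indicator_Icc[OF contC']]
    by (cases "a < b") (simp_all add: borel_measurable_add)
  have "continue (reward \<kappa> C C') a b = (\<integral>c. k c \<partial>U)"
    unfolding continue_def
  proof (rule integral_cong_AE)
    obtain K where "\<And>a b. a \<in> {0..1} \<Longrightarrow> b \<in> {0..1} \<Longrightarrow> \<bar>reward \<kappa> C C' a b\<bar> \<le> K"
      by (rule reward_bounded[where \<kappa>=\<kappa>]) blast
    from integrable_continue[OF borel_measurable_reward this b]
    show "(\<lambda>c. if a < b \<and> b < c \<or> b < c \<and> c < a then 0 else reward \<kappa> C C' b c) \<in> borel_measurable U"
      by (rule borel_measurable_integrable)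
    show "k \<in> borel_measurable U"
      unfolding measurable_cong_sets[OF sets_U refl] by (rule k)
    show "AE c in U. (if a < b \<and> b < c \<or> b < c \<and> c < a then 0 else reward \<kappa> C C' b c) = k c"
      using AE_U AE_U_neq[of a] AE_U_neq[of b]
      by eventually_elim (use a b in \<open>auto simp: k_def f_def reward_def indicator_def\<close>)
  qed
  also have "\<dots> = (\<integral>c. k c \<partial>lborel)"
    unfolding integral_U[OF k]
    by (rule Bochner_Integration.integral_cong) (use a b in \<open>auto simp: k_def indicator_def\<close>)
  also have "\<dots> = (F b - F 0) + (if a < b then 0 else - C (1 - 1) - - C (1 - a))"
  proof (cases "a < b")
    case True
    then show ?thesis
      using integral_indicator_Icc_FTC[OF _ contf dF, of 0 b] b by (simp add: k_def)
  next
    case False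
    have "(\<integral>c. k c \<partial>lborel) = (\<integral>c. indicator {0..b} c * f c \<partial>lborel) +
        (\<integral>c. indicator {a..1} c * C' (1 - c) \<partial>lborel)"
      using False by (simp add: k_def Bochner_Integration.integral_add[OF integrable_indicator_Icc[OF contf] integrable_indicator_Icc[OF contC']])
    then show ?thesis
      using integral_indicator_Icc_FTC[OF _ contf dF, of 0 b] integral_indicator_Icc_FTC[OF _ contC' dC, of a 1] a b False by simp
  qed
  finally show ?thesis
    by (cases "a < b") (simp_all add: F_def C_0 field_simps power2_eq_square)
qed

end

text \<open>
The comparison principle: the race ends so fast that a bounded function which is dominated by its
own expected continuation cannot be positive. The witness is a bound \<open>G\<close> for the expected length of
the race: \<open>1 \<le> G \<le> 8\<close> and \<open>continue G \<le> G - 1\<close>, hence \<open>continue G \<le> 7/8 G\<close>, and iteration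
gives \<open>\<delta> \<le> K (7/8)\<^sup>n G\<close> for all \<open>n\<close>.
\<close>

lemma nonpos_if_le_continue:
  assumes meas: "\<And>b. \<delta> b \<in> borel_measurable borel"
    and bound: "\<And>a b. a \<in> {0..1} \<Longrightarrow> b \<in> {0..1} \<Longrightarrow> \<bar>\<delta> a b\<bar> \<le> K"
    and step: "\<And>a b. a \<in> {0..1} \<Longrightarrow> b \<in> {0..1} \<Longrightarrow> \<delta> a b \<le> continue \<delta> a b"
    and "a \<in> {0..1}" "b \<in> {0..1}"
  shows "\<delta> a b \<le> 0"
proof -
  \<comment> \<open>The expected length solves \<open>C' + s C = 1 + C 1\<close>. This is a truncation of its power series at
    an order where the left-hand side is too large by \<open>s^6 / 4\<close>, with \<open>1 + C 1 = 15 / 4\<close>.\<close>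
  define g g' :: "real \<Rightarrow> real" where
    "g = (\<lambda>s. 15 / 4 * s - 5 / 4 * s ^ 3 + s ^ 5 / 4)" and
    "g' = (\<lambda>s. 15 / 4 - 15 / 4 * s ^ 2 + 5 / 4 * s ^ 4)"
  interpret potential g g'
    by unfold_locales
      (auto simp: g_def g'_def intro!: derivative_eq_intros continuous_intros)
  let ?G = "reward 0 g g'"
  have G: "1 \<le> ?G a b" "?G a b \<le> 8" "continue ?G a b \<le> ?G a b - 1"
    if ab: "a \<in> {0..1}" "b \<in> {0..1}" for a b
  proof -
    have g: "0 \<le> g s" "g s \<le> 4" if "s \<in> {0..1}" for s
    proof -
      have "s ^ 3 \<le> s" "s ^ 5 \<le> 1" "0 \<le> s ^ 5" "0 \<le> s ^ 3"
        using that power_decreasing[of 1 3 s] by (auto intro: power_le_one)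
      with that show "0 \<le> g s" "g s \<le> 4"
        unfolding g_def atLeastAtMost_iff by linarith+
    qed
    have g': "1 \<le> g' s" "g' s \<le> 4" if "s \<in> {0..1}" for s
    proof -
      have t: "0 \<le> s\<^sup>2" "s\<^sup>2 \<le> 1" "s ^ 4 \<le> s ^ 2"
        using that power_decreasing[of 2 4 s] by (auto intro: power_le_one)
      have "0 \<le> (1 - s\<^sup>2) * (2 - s\<^sup>2)"
        using t by (intro mult_nonneg_nonneg) auto
      then have "0 \<le> 2 - 3 * s\<^sup>2 + s ^ 4"
        by (simp add: algebra_simps flip: power_add)
      then show "1 \<le> g' s" "g' s \<le> 4"
        using t unfolding g'_def by linarith+
    qed
    show "1 \<le> ?G a b" "?G a b \<le> 8"
      using g[of "1 - a"] g'[of "1 - b"] ab by (auto simp: reward_def)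
    have "g' s - 1 - (g 1 - s * g s) = s ^ 6 / 4" for s
      by (simp add: g_def g'_def field_simps power_numeral_reduce)
    moreover have "0 \<le> (1 - b) ^ 6 / 4"
      by simp
    ultimately have "g 1 - (1 - b) * g (1 - b) \<le> g' (1 - b) - 1"
      by (metis diff_ge_0_iff_ge)
    then show "continue ?G a b \<le> ?G a b - 1"
      using continue_reward[OF ab, of 0] by (simp add: reward_def)
  qed
  have K: "0 \<le> K"
    using bound[of 0 0] by simp
  have iter: "\<delta> a b \<le> K * (7 / 8) ^ n * ?G a b" if "a \<in> {0..1}" "b \<in> {0..1}" for a b n
    using that
  proof (induction n arbitrary: a b)
    case 0
    have "\<delta> a b \<le> K * 1"
      using bound[OF 0] by simp
    also have "\<dots> \<le> K * ?G a b"
      using G(1)[OF 0] K by (rule mult_left_mono)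
    finally show ?case by simp
  next
    case (Suc n)
    let ?r = "K * (7 / 8) ^ n"
    have r: "0 \<le> ?r"
      using K by simp
    have "\<delta> a b \<le> continue \<delta> a b"
      by (rule step[OF Suc.prems])
    also have "\<dots> \<le> continue (\<lambda>b c. ?r * ?G b c) a b"
    proof (rule continue_mono[where H=K and K="?r * 8"])
      show "(\<lambda>c. ?r * ?G b c) \<in> borel_measurable borel" for b
        using borel_measurable_reward by (rule borel_measurable_times[OF borel_measurable_const])
      show "\<bar>?r * ?G b c\<bar> \<le> ?r * 8" if "b \<in> {0..1}" "c \<in> {0..1}" for b c
        using G(1,2)[OF that] K unfolding abs_mult by (intro mult_mono) auto
    qed (use meas bound Suc in auto)
    also have "\<dots> = ?r * continue ?G a b"
      by (rule continue_mult)
    also have "\<dots> \<le> ?r * (7 / 8 * ?G a b)"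
      using G[OF Suc.prems] r by (intro mult_left_mono) auto
    finally show ?case by simp
  qed
  have "(\<lambda>n. K * (7 / 8) ^ n * ?G a b) \<longlonglongrightarrow> K * 0 * ?G a b"
    by (intro tendsto_intros LIMSEQ_power_zero) simp
  then show ?thesis
    using iter[OF assms(4,5)] by (intro LIMSEQ_le_const[where a="\<delta> a b"]) auto
qed

context potential
begin

text \<open>
Applied to \<open>\<epsilon> (win - reward 1 C C')\<close>, the comparison principle turns a sign of the residual of the
differential equation into a bound: an upper one for \<open>\<epsilon> = 1\<close>, a lower one for \<open>\<epsilon> = -1\<close>.
\<close>

lemma win_compare_reward:
  assumes \<epsilon>: "\<epsilon> = 1 \<or> \<epsilon> = -1"
    and residual: "\<And>s. s \<in> {0..1} \<Longrightarrow>
      0 \<le> \<epsilon> * (C' s - (s + C 1 - s * C s - (1 - s\<^sup>2) / 2))"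
    and ab: "a \<in> {0..1}" "b \<in> {0..1}"
  shows "\<epsilon> * win a b \<le> \<epsilon> * reward 1 C C' a b"
proof -
  let ?h = "reward 1 C C'"
  define \<delta> where "\<delta> = (\<lambda>a b. \<epsilon> * win a b + (- \<epsilon>) * ?h a b)"
  obtain K where K: "\<And>a b. a \<in> {0..1} \<Longrightarrow> b \<in> {0..1} \<Longrightarrow> \<bar>?h a b\<bar> \<le> K"
    by (rule reward_bounded) blast
  have win1: "\<bar>\<epsilon> * win a b\<bar> \<le> 1" for a b
    using \<epsilon> win_bounds[of a b] by auto
  have hK: "\<bar>(- \<epsilon>) * ?h a b\<bar> \<le> K" if "a \<in> {0..1}" "b \<in> {0..1}" for a b
    using \<epsilon> K[OF that] by auto
  have m1: "(\<lambda>c. \<epsilon> * win b c) \<in> borel_measurable borel" for b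
    by (rule borel_measurable_times[OF borel_measurable_const borel_measurable_win])
  have m2: "(\<lambda>c. (- \<epsilon>) * ?h b c) \<in> borel_measurable borel" for b
    by (rule borel_measurable_times[OF borel_measurable_const borel_measurable_reward])
  have "\<delta> a b \<le> 0"
  proof (rule nonpos_if_le_continue[where \<delta>=\<delta> and K="1 + K"])
    show "\<delta> b \<in> borel_measurable borel" for b
      unfolding \<delta>_def by (rule borel_measurable_add[OF m1 m2])
    show "\<bar>\<delta> a b\<bar> \<le> 1 + K" if "a \<in> {0..1}" "b \<in> {0..1}" for a b
      using win1[of a b] hK[OF that] unfolding \<delta>_def by linarith
    show "\<delta> a b \<le> continue \<delta> a b" if "a \<in> {0..1}" "b \<in> {0..1}" for a b
    proof -
      have cont: "continue \<delta> a b = \<epsilon> * continue win a b + (- \<epsilon>) * continue ?h a b"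
        unfolding \<delta>_def
        using continue_add[OF m1 m2 win1 hK that(2)] by (simp only: continue_mult)
      have "?h a b - (if a < b then 1 - b else 0) - continue ?h a b =
          C' (1 - b) - ((1 - b) + C 1 - (1 - b) * C (1 - b) - (1 - (1 - b)\<^sup>2) / 2)"
        unfolding continue_reward[OF that] by (simp add: reward_def)
      then have "0 \<le> \<epsilon> * (?h a b - (if a < b then 1 - b else 0) - continue ?h a b)"
        using residual[of "1 - b"] that by simp
      moreover have "\<delta> a b = \<epsilon> * ((if a < b then 1 - b else 0) + continue win a b) + (- \<epsilon>) * ?h a b"
        using win_eq[OF that(2), of a] by (simp add: \<delta>_def)
      ultimately show ?thesis
        unfolding cont right_diff_distrib distrib_left by linarith
    qed
  qed (use ab in auto)
  then show ?thesis
    by (simp add: \<delta>_def)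
qed

text \<open>
The bound at the diagonal states \<open>(a, a)\<close>, integrated over the first entry \<open>a\<close> of the race.
\<close>

lemma prob_wins_compare:
  assumes \<epsilon>: "\<epsilon> = 1 \<or> \<epsilon> = -1"
    and residual: "\<And>s. s \<in> {0..1} \<Longrightarrow>
      0 \<le> \<epsilon> * (C' s - (s + C 1 - s * C s - (1 - s\<^sup>2) / 2))"
    and D: "\<And>s. (D has_real_derivative C s) (at s)"
  shows "\<epsilon> * measure U.S {x. wins x} \<le> \<epsilon> * (C 1 - 1 / 2 + D 1 - D 0)"
proof -
  define d where "d = (\<lambda>a. C' (1 - a) - (1 - a) + C (1 - a))"
  define E where "E = (\<lambda>a. - C (1 - a) + (1 - a)\<^sup>2 / 2 - D (1 - a))"
  have cont_d: "continuous_on A d" for A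
    unfolding d_def
    by (intro continuous_intros continuous_on_compose2[OF cont] continuous_on_compose2[OF cont_C]) auto
  have d1: "((\<lambda>a. 1 - a) has_real_derivative - 1) (at a)" for a :: real
    by (auto intro!: derivative_eq_intros)
  have dC: "((\<lambda>a. C (1 - a)) has_real_derivative - C' (1 - a)) (at a)" for a
    using DERIV_chain2[OF deriv d1] by simp
  have dD: "((\<lambda>a. D (1 - a)) has_real_derivative - C (1 - a)) (at a)" for a
    using DERIV_chain2[OF D d1] by simp
  have dE: "(E has_real_derivative d a) (at a)" for a
  proof -
    have "((\<lambda>a. (1 - a)\<^sup>2 / 2) has_real_derivative - (1 - a)) (at a)"
      by (rule derivative_eq_intros refl | simp)+
    from DERIV_diff[OF DERIV_add[OF DERIV_minus[OF dC] this] dD] show ?thesis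
      by (simp add: E_def d_def algebra_simps)
  qed
  have d: "d \<in> borel_measurable borel"
    by (rule borel_measurable_continuous_onI[OF cont_d])
  have "bounded (d ` {0..1})"
    by (intro compact_imp_bounded compact_continuous_image cont_d) auto
  then obtain K where K: "\<And>a. a \<in> {0..1} \<Longrightarrow> \<bar>d a\<bar> \<le> K"
    unfolding bounded_iff by (metis imageI real_norm_def)
  let ?m = "\<lambda>a. measure U.S {x. wins (case_nat a x)}"
  have m: "?m \<in> borel_measurable borel"
    by (rule U.borel_measurable_prob_first_entry[OF pred_wins])
  have "\<epsilon> * measure U.S {x. wins x} = (\<integral>a. \<epsilon> * ?m a \<partial>U)"
    using U.prob_first_entry(2)[OF pred_wins] by simp
  also have "\<dots> \<le> (\<integral>a. \<epsilon> * d a \<partial>U)"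
  proof (rule integral_mono_AE)
    show "integrable U (\<lambda>a. \<epsilon> * ?m a)"
      by (rule integrable_mult_right, rule integrable_U[OF m, of 1]) auto
    show "integrable U (\<lambda>a. \<epsilon> * d a)"
      by (rule integrable_mult_right, rule integrable_U[OF d K])
    show "AE a in U. \<epsilon> * ?m a \<le> \<epsilon> * d a"
      using AE_U
    proof eventually_elim
      case (elim a)
      have "d a = reward 1 C C' a a"
        by (simp add: d_def reward_def)
      then show ?case
        using win_compare_reward[OF \<epsilon> residual elim elim] prob_wins_first_entry[OF elim] by simp
    qed
  qed
  also have "\<dots> = \<epsilon> * (E 1 - E 0)"
    using integral_indicator_Icc_FTC[OF _ cont_d dE, of 0 1] integral_U[OF d] by simp
  finally show ?thesis
    by (simp add: E_def C_0 algebra_simps)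
qed

end

text \<open>
The exact \<open>C\<close> solves \<open>C' + s C = (C 1 - 1/2) + s + s\<^sup>2/2\<close> with \<open>C 0 = 0\<close>. Writing \<open>C 1 = 1 - q\<close> on the
right, its power series has coefficients affine in \<open>q\<close>, and \<open>C 1 = 1 - q\<close> holds for one \<open>q\<close>, about
\<open>0.38706\<close>. Truncation after \<open>s^11\<close> leaves positive terms \<open>s^11\<close>, \<open>s^12\<close> in the residual, and a \<open>q\<close>
slightly below the exact one makes the constant term positive too. This gives an upper bound.
\<close>

lemma prob_wins_less: "measure U.S {x. wins x} < 0.3425"
proof -
  define q :: real where "q = 0.3869"
  define C C' D :: "real \<Rightarrow> real" where
    "C = (\<lambda>s. (1/2 - q) * s + s^2 / 2 + q * s^3 / 3 - s^4 / 8 - q * s^5 / 15 + s^6 / 48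
        + q * s^7 / 105 - s^8 / 384 - q * s^9 / 945 + s^10 / 3840 + q * s^11 / 10395)" and
    "C' = (\<lambda>s. (1/2 - q) + s + q * s^2 - s^3 / 2 - q * s^4 / 3 + s^5 / 8
        + q * s^6 / 15 - s^7 / 48 - q * s^8 / 105 + s^9 / 384 + q * s^10 / 945)" and
    "D = (\<lambda>s. (1/2 - q) * s^2 / 2 + s^3 / 6 + q * s^4 / 12 - s^5 / 40 - q * s^6 / 90 + s^7 / 336
        + q * s^8 / 840 - s^9 / 3456 - q * s^10 / 9450 + s^11 / 42240 + q * s^12 / 124740)"
  interpret potential C C'
    by unfold_locales
      (auto simp: C_def C'_def intro!: derivative_eq_intros continuous_intros)
  have "0 \<le> 1 * (C' s - (s + C 1 - s * C s - (1 - s\<^sup>2) / 2))" if "s \<in> {0..1}" for s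
  proof -
    have "1 * (C' s - (s + C 1 - s * C s - (1 - s\<^sup>2) / 2)) =
        1 - q - C 1 + s ^ 11 / 3840 + q * s ^ 12 / 10395"
      by (simp add: C_def C'_def field_simps power_numeral_reduce)
    also have "0 \<le> \<dots>"
      using that by (intro add_nonneg_nonneg) (simp_all add: C_def q_def)
    finally show ?thesis .
  qed
  moreover have "(D has_real_derivative C s) (at s)" for s
    unfolding C_def D_def by (auto intro!: derivative_eq_intros)
  ultimately have "1 * measure U.S {x. wins x} \<le> 1 * (C 1 - 1 / 2 + D 1 - D 0)"
    by (rule prob_wins_compare[of 1, rotated]) simp_all
  also have "\<dots> < 0.3425"
    by (simp add: C_def D_def q_def)
  finally show ?thesis by simp
qed

text \<open>
Truncation after \<open>s^10\<close> and a \<open>q\<close> slightly above the exact one give a residual of the opposite sign.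
\<close>

lemma prob_wins_greater: "measure U.S {x. wins x} > 0.3415"
proof -
  define q :: real where "q = 0.3872"
  define C C' D :: "real \<Rightarrow> real" where
    "C = (\<lambda>s. (1/2 - q) * s + s^2 / 2 + q * s^3 / 3 - s^4 / 8 - q * s^5 / 15 + s^6 / 48
        + q * s^7 / 105 - s^8 / 384 - q * s^9 / 945 + s^10 / 3840)" and
    "C' = (\<lambda>s. (1/2 - q) + s + q * s^2 - s^3 / 2 - q * s^4 / 3 + s^5 / 8
        + q * s^6 / 15 - s^7 / 48 - q * s^8 / 105 + s^9 / 384)" and
    "D = (\<lambda>s. (1/2 - q) * s^2 / 2 + s^3 / 6 + q * s^4 / 12 - s^5 / 40 - q * s^6 / 90 + s^7 / 336
        + q * s^8 / 840 - s^9 / 3456 - q * s^10 / 9450 + s^11 / 42240)"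
  interpret potential C C'
    by unfold_locales
      (auto simp: C_def C'_def intro!: derivative_eq_intros continuous_intros)
  have "0 \<le> -1 * (C' s - (s + C 1 - s * C s - (1 - s\<^sup>2) / 2))" if "s \<in> {0..1}" for s
  proof -
    have "-1 * (C' s - (s + C 1 - s * C s - (1 - s\<^sup>2) / 2)) =
        C 1 - (1 - q) + s ^ 10 * (q / 945 - s / 3840)"
      by (simp add: C_def C'_def field_simps power_numeral_reduce)
    also have "0 \<le> \<dots>"
      using that by (intro add_nonneg_nonneg mult_nonneg_nonneg) (simp_all add: C_def q_def)
    finally show ?thesis .
  qed
  moreover have "(D has_real_derivative C s) (at s)" for s
    unfolding C_def D_def by (auto intro!: derivative_eq_intros)
  ultimately have "-1 * measure U.S {x. wins x} \<le> -1 * (C 1 - 1 / 2 + D 1 - D 0)"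
    by (rule prob_wins_compare[of "-1", rotated]) simp_all
  also have "\<dots> < - 0.3415"
    by (simp add: C_def D_def q_def)
  finally show ?thesis by simp
qed

theorem corollary4p11:
  fixes M :: "'a measure" and X :: "nat \<Rightarrow> 'a \<Rightarrow> real"
  assumes "iid_continuous M X"
  shows "((\<lambda>n. \<Sum>i=1..n. \<Sum>j\<in>{1..n} - {i}. real (t_count n i j) / fact n)
            has_sum prob_before M X [1, 2, 3] [3, 1, 2]) {3..} \<and>
         \<bar>prob_before M X [1, 2, 3] [3, 1, 2] - 0.342\<bar> < 0.0005"
proof -
  let ?f = "\<lambda>n. card (Av_ending n [1, 2, 3] [3, 1, 2]) / fact n :: real"
  interpret law: continuous_law "distr M borel (X 0)"
    by (rule iid_law(1)[OF assms])
  have sum: "(?f has_sum prob_before M X [1, 2, 3] [3, 1, 2]) {3..}"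
    using law.has_sum_prob_before[of "[3, 1, 2]" "[1, 2, 3]"] iid_law(2)[OF assms]
    by (simp add: numeral_3_eq_3)
  have "(?f has_sum measure U.S {x. wins x}) {3..}"
    using U.has_sum_prob_before[of "[3, 1, 2]" "[1, 2, 3]"] by (simp add: wins_def numeral_3_eq_3)
  then have "prob_before M X [1, 2, 3] [3, 1, 2] = measure U.S {x. wins x}"
    using has_sum_unique[OF sum] by simp
  then have "\<bar>prob_before M X [1, 2, 3] [3, 1, 2] - 0.342\<bar> < 0.0005"
    using prob_wins_less prob_wins_greater by (auto simp: abs_if)
  moreover have "?f n = (\<Sum>i=1..n. \<Sum>j\<in>{1..n} - {i}. real (t_count n i j) / fact n)"
    if "n \<in> {3..}" for n
    using sum_t_count[of n] that by (simp add: sum_divide_distrib[symmetric] flip: of_nat_sum)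
  ultimately show ?thesis
    using sum has_sum_cong[of "{3..}" ?f] by auto
qed

end
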